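(* Let $q\in\mathbb{C}$ with $|q|<1$, let $k\ge 1$ be an integer, and let $a_1,b_1,\ldots,a_k,b_k\in\mathbb{C}$. If $f(x_1,y_1,\ldots,x_k,y_k)$ is a $2k$-variable analytic function at $(0,\ldots,0)\in\mathbb{C}^{2k}$, then $f$ can be expanded in terms of $$\Phi_{n_1}^{(a_1,b_1)}(x_1,y_1|q)\cdots\Phi_{n_k}^{(a_k,b_k)}(x_k,y_k|q)$$ (that is, there are coefficients $\lambda_{n_1,\ldots,n_k}\in\mathbb{C}$ independent of $x_1,y_1,\ldots,x_k,y_k$ such that $f(x_1,y_1,\ldots,x_k,y_k)=\sum_{n_1,\ldots,n_k=0}^\infty \lambda_{n_1,\ldots,n_k}\Phi_{n_1}^{(a_1,b_1)}(x_1,y_1|q)\cdots\Phi_{n_k}^{(a_k,b_k)}(x_k,y_k|q)$ near the origin) if and only if $f$ satisfies the following system of $q$-partial differential equations: $$\partial_{q,x_j}(1-b_j\eta_{y_j})\{f\}=\partial_{q,y_j}(1-a_j\eta_{x_j})\{f\},\qquad j\in\{1,2,\ldots,k\}.$$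
   Context: For $a\in\mathbb{C}$ the $q$-shifted factorials are $(a;q)_0=1$, $(a;q)_n=\prod_{i=0}^{n-1}(1-aq^i)$ for $n\ge 1$. The $q$-binomial coefficient is ${n\brack k}_q=\frac{(q;q)_n}{(q;q)_k(q;q)_{n-k}}$. The homogeneous polynomials are $\Phi_n^{(\alpha,\beta)}(x,y|q)=\sum_{k=0}^n {n\brack k}_q(\alpha;q)_k(\beta;q)_{n-k}x^ky^{n-k}$. The $q$-derivative of a one-variable function is $D_q\{f(x)\}=\frac{f(x)-f(qx)}{x}$ (no factor $1-q$), and the $q$-partial derivative $\partial_{q,x}\{f\}$ of a function of several variables is its $q$-derivative with respect to $x$, the other variables being regarded as constants. The $q$-shift operator on the variable $x$, denoted $\eta_x$, replaces $x$ by $qx$ and leaves all other variables unchanged; thus $(1-b\,\eta_y)\{f\}=f-b\,\eta_y\{f\}$.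
   Formalization: That the system implies the expansion is proved only if for no j both a_j q^r = 1 and b_j q^s = 1 for some integers r, s ≥ 0; otherwise it fails (k = 1, a_1 = b_1 = 1, f = x_1). That the expansion implies the system is proved for all parameters. *)

theory Defs
  imports "HOL-Analysis.Analysis"
begin

definition qpoch :: "complex \<Rightarrow> complex \<Rightarrow> nat \<Rightarrow> complex" where
  "qpoch a q n = (\<Prod>i<n. 1 - a * q ^ i)"

definition qbinom :: "complex \<Rightarrow> nat \<Rightarrow> nat \<Rightarrow> complex" where
  "qbinom q n k = qpoch q q n / (qpoch q q k * qpoch q q (n - k))"

definition Phi :: "complex \<Rightarrow> complex \<Rightarrow> complex \<Rightarrow> nat \<Rightarrow> complex \<Rightarrow> complex \<Rightarrow> complex" where
  "Phi q \<alpha> \<beta> n x y =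
     (\<Sum>k\<le>n. qbinom q n k * qpoch \<alpha> q k * qpoch \<beta> q (n - k) * x ^ k * y ^ (n - k))"

text \<open>
  The quotient \<open>(g x - g (q x)) / x\<close> has no value at \<open>x = 0\<close> (and would be \<open>0\<close> by the HOL
  convention on division); there it is replaced by its limit, that is, by its continuous extension.
\<close>

definition qderiv :: "complex \<Rightarrow> (complex \<Rightarrow> complex) \<Rightarrow> complex \<Rightarrow> complex" where
  "qderiv q g x =
     (if x = 0 then Lim (at 0) (\<lambda>t. (g t - g (q * t)) / t) else (g x - g (q * x)) / x)"

definition upd :: "complex ^ 'n \<Rightarrow> 'n \<Rightarrow> complex \<Rightarrow> complex ^ 'n" where
  "upd z i t = (\<chi> l. if l = i then t else z $ l)"

definition qpartial ::
    "complex \<Rightarrow> 'n \<Rightarrow> (complex ^ 'n \<Rightarrow> complex) \<Rightarrow> complex ^ 'n \<Rightarrow> complex" where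
  "qpartial q i f z = qderiv q (\<lambda>t. f (upd z i t)) (z $ i)"

definition qshift ::
    "complex \<Rightarrow> 'n \<Rightarrow> (complex ^ 'n \<Rightarrow> complex) \<Rightarrow> complex ^ 'n \<Rightarrow> complex" where
  "qshift q i f z = f (upd z i (q * z $ i))"

text \<open>
  Analyticity at a point in several complex variables: a power series, indexed by all multi-indices
  and summed unconditionally (hence absolutely), represents the function in a neighbourhood.
\<close>

definition mv_analytic_at :: "(complex ^ 'n::finite \<Rightarrow> complex) \<Rightarrow> complex ^ 'n \<Rightarrow> bool" where
  "mv_analytic_at f w \<longleftrightarrow>
     (\<exists>c :: ('n \<Rightarrow> nat) \<Rightarrow> complex. \<forall>\<^sub>F z in nhds w.
        ((\<lambda>m. c m * (\<Prod>i\<in>UNIV. (z $ i - w $ i) ^ m i)) has_sum f z) UNIV)"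

text \<open>
  The \<open>2k\<close> variables are the coordinates of a vector indexed by \<open>'k + 'k\<close>, where \<open>k\<close> is the
  cardinality of \<open>'k\<close>: \<open>x\<^sub>j\<close> is \<open>z $ Inl j\<close> and \<open>y\<^sub>j\<close> is \<open>z $ Inr j\<close>.
\<close>

definition Phi_expandable ::
    "complex \<Rightarrow> ('k::finite \<Rightarrow> complex) \<Rightarrow> ('k \<Rightarrow> complex) \<Rightarrow> (complex ^ ('k + 'k) \<Rightarrow> complex) \<Rightarrow> bool"
  where
  "Phi_expandable q a b f \<longleftrightarrow>
     (\<exists>lam :: ('k \<Rightarrow> nat) \<Rightarrow> complex. \<forall>\<^sub>F z in nhds 0.
        ((\<lambda>n. lam n * (\<Prod>j\<in>UNIV. Phi q (a j) (b j) (n j) (z $ Inl j) (z $ Inr j)))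
           has_sum f z) UNIV)"

definition q_pde_system ::
    "complex \<Rightarrow> ('k::finite \<Rightarrow> complex) \<Rightarrow> ('k \<Rightarrow> complex) \<Rightarrow> (complex ^ ('k + 'k) \<Rightarrow> complex) \<Rightarrow> bool"
  where
  "q_pde_system q a b f \<longleftrightarrow>
     (\<forall>j. \<forall>\<^sub>F z in nhds 0.
        qpartial q (Inl j) (\<lambda>w. f w - b j * qshift q (Inr j) f w) z =
        qpartial q (Inr j) (\<lambda>w. f w - a j * qshift q (Inl j) f w) z)"

text \<open>
  If \<open>a\<^sub>j = q\<^sup>-\<^sup>r\<close> and \<open>b\<^sub>j = q\<^sup>-\<^sup>s\<close> for some \<open>r\<close>, \<open>s\<close> in the naturals, then \<open>Phi q (a j) (b j) n\<close> is
  the zero polynomial for all \<open>n > r + s\<close>, whereas the system has nonzero solutions that are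
  homogeneous of degree \<open>r + s + 1\<close> in \<open>x\<^sub>j, y\<^sub>j\<close>, so it does not imply expandability. The
  predicate excludes exactly these parameters.
\<close>

definition nondegenerate ::
    "complex \<Rightarrow> ('k \<Rightarrow> complex) \<Rightarrow> ('k \<Rightarrow> complex) \<Rightarrow> bool" where
  "nondegenerate q a b \<longleftrightarrow>
     (\<forall>j. \<not> ((\<exists>r::nat. a j * q ^ r = 1) \<and> (\<exists>s::nat. b j * q ^ s = 1)))"

text \<open>The simplest instance of the failure: \<open>a\<^sub>j = b\<^sub>j = 1\<close> and \<open>f = x\<^sub>j\<close>.\<close>

lemma degenerate_counterexample:
  fixes j :: "'k::finite"
  defines "f \<equiv> (\<lambda>z :: complex ^ ('k + 'k). z $ Inl j)"
  shows "mv_analytic_at f 0"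
    and "q_pde_system q (\<lambda>_. 1) (\<lambda>_. 1) f"
    and "\<not> Phi_expandable q (\<lambda>_. 1) (\<lambda>_. 1) f"
proof -
  let ?e = "\<lambda>i :: 'k + 'k. if i = Inl j then 1 else 0 :: nat"
  have "((\<lambda>m. (if m = ?e then 1 else 0) * (\<Prod>i\<in>UNIV. (z $ i - 0 $ i) ^ m i)) has_sum f z) UNIV"
    for z :: "complex ^ ('k + 'k)"
  proof -
    have p: "(\<Prod>i\<in>UNIV. (z $ i) ^ ?e i) = z $ Inl j"
    proof -
      have "(\<Prod>i\<in>UNIV. (z $ i) ^ ?e i) = (\<Prod>i\<in>UNIV. if i = Inl j then z $ i else 1)"
        by (intro prod.cong) auto
      also have "\<dots> = z $ Inl j" by simp
      finally show ?thesis .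
    qed
    have "((\<lambda>m. (if m = ?e then 1 else 0) * (\<Prod>i\<in>UNIV. (z $ i - 0 $ i) ^ m i)) has_sum
        (\<Sum>m\<in>{?e}. (if m = ?e then 1 else 0) * (\<Prod>i\<in>UNIV. (z $ i - 0 $ i) ^ m i))) UNIV"
      by (intro has_sum_finite_neutralI[where B = "{?e}"]) auto
    with p show ?thesis by (simp add: f_def)
  qed
  then show "mv_analytic_at f 0"
    unfolding mv_analytic_at_def by (intro exI always_eventually allI)
  have L: "Lim (at 0) (\<lambda>t :: complex. 0 :: complex) = 0"
    by (rule tendsto_Lim) auto
  show "q_pde_system q (\<lambda>_. 1) (\<lambda>_. 1) f"
    by (auto simp: q_pde_system_def qpartial_def qderiv_def qshift_def upd_def f_def L
        intro!: always_eventually)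
  have P1: "qpoch 1 q n = (if n = 0 then 1 else 0)" for n
    by (auto simp: qpoch_def prod_zero_iff intro!: bexI[of _ 0])
  have Pz: "Phi q 1 1 n x y = 0" if "n > 0" for n x y
    using that by (auto simp: Phi_def P1 intro!: sum.neutral)
  show "\<not> Phi_expandable q (\<lambda>_. 1) (\<lambda>_. 1) f"
  proof
    assume "Phi_expandable q (\<lambda>_. 1) (\<lambda>_. 1) f"
    then obtain l :: "('k \<Rightarrow> nat) \<Rightarrow> complex" where
      l: "\<forall>\<^sub>F z in nhds 0. ((\<lambda>n. l n * (\<Prod>j\<in>UNIV. Phi q 1 1 (n j) (z $ Inl j) (z $ Inr j)))
           has_sum f z) UNIV"
      unfolding Phi_expandable_def by blast
    have "f z = l (\<lambda>_. 0)"
      if h: "((\<lambda>n. l n * (\<Prod>j\<in>UNIV. Phi q 1 1 (n j) (z $ Inl j) (z $ Inr j))) has_sum f z) UNIV"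
      for z :: "complex ^ ('k + 'k)"
    proof -
      have "l n * (\<Prod>j\<in>UNIV. Phi q 1 1 (n j) (z $ Inl j) (z $ Inr j)) = 0" if "n \<noteq> (\<lambda>_. 0)" for n
      proof -
        from that obtain i where "n i > 0" by (auto simp: fun_eq_iff)
        then have "Phi q 1 1 (n i) (z $ Inl i) (z $ Inr i) = 0" by (rule Pz)
        then show ?thesis by (auto simp: prod_zero_iff)
      qed
      then have "((\<lambda>n. l n * (\<Prod>j\<in>UNIV. Phi q 1 1 (n j) (z $ Inl j) (z $ Inr j))) has_sum
        (\<Sum>n\<in>{\<lambda>_. 0}. l n * (\<Prod>j\<in>UNIV. Phi q 1 1 (n j) (z $ Inl j) (z $ Inr j)))) UNIV"
        by (intro has_sum_finite_neutralI[where B = "{\<lambda>_. 0}"]) auto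
      from has_sum_unique[OF h this] show ?thesis
        by (simp add: Phi_def qbinom_def qpoch_def)
    qed
    with l have "\<forall>\<^sub>F z in nhds 0. f z = l (\<lambda>_. 0)"
      by (auto elim: eventually_mono)
    then obtain e where e: "e > 0" "\<And>z. dist z 0 < e \<Longrightarrow> f z = l (\<lambda>_. 0)"
      by (auto simp: eventually_nhds_metric)
    define z :: "complex ^ ('k + 'k)" where "z = axis (Inl j) (of_real (e / 2))"
    have "norm z < e"
    proof -
      have "(\<Sum>i\<in>UNIV. (norm (z $ i))\<^sup>2) =
          (\<Sum>i\<in>(UNIV :: ('k + 'k) set). if i = Inl j then (e / 2)\<^sup>2 else 0)"
        by (intro sum.cong) (auto simp: z_def axis_def power_divide)
      then have "norm z = e / 2"
        using e(1) by (simp add: norm_vec_def L2_set_def)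
      then show ?thesis using e(1) by simp
    qed
    then have "f z = f 0" using e by simp
    then show False using e(1) by (simp add: f_def z_def axis_def)
  qed
qed

end

theory Submission
  imports Defs
begin

text \<open>
  Everything is read off from the Taylor coefficients \<open>c m\<close> of \<open>f\<close> at the origin, where
  \<open>m :: 'k + 'k \<Rightarrow> nat\<close> is a multi-index.

  The q-shift multiplies \<open>c m\<close> by a power of \<open>q\<close>, and the q-derivative in the \<open>i\<close>-th variable turns
  the coefficients into \<open>(1 - q ^ Suc (m i)) * c (m + e\<^sub>i)\<close> (lemma \<open>power_series_on_qpartial\<close>). As
  coefficients are unique, the system is therefore equivalent to a recurrence that, for each \<open>j\<close>,
  links \<open>c\<close> at two neighbours in which one unit of degree has moved from \<open>x\<^sub>j\<close> to \<open>y\<^sub>j\<close>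
  (\<open>q_pde_system_iff_recurrence\<close>). It never changes the total degree \<open>n\<^sub>j\<close> in the pair
  \<open>x\<^sub>j, y\<^sub>j\<close>.

  On the other side, the product of the polynomials \<open>Phi\<close> of degrees \<open>n\<^sub>j\<close> is homogeneous of degree
  \<open>n\<^sub>j\<close> in each pair, with coefficients \<open>Phi_coeff\<close>. Scaling each pair by its own parameter \<open>t\<^sub>j\<close>
  separates the homogeneous components of \<open>f\<close>, so that \<open>f\<close> is expandable exactly if
  \<open>c m = lam (pair_degree m) * Phi_coeff q a b m\<close> for some \<open>lam\<close> (\<open>Phi_expandable_iff_coeff\<close>).

  It remains to compare the two conditions on \<open>c\<close>. The numbers \<open>Phi_coeff\<close> solve the recurrence,
  and multiplying a solution by a function of the pair degrees gives a solution; hence expandability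
  implies the system. For nondegenerate parameters and each \<open>j\<close>, one of the two factors
  \<open>1 - a\<^sub>j q\<^sup>r\<close>, \<open>1 - b\<^sub>j q\<^sup>r\<close> of the recurrence vanishes for no \<open>r\<close>, so all degree in the \<open>j\<close>-th pair can be pushed
  into one of its variables. The solution is then determined, for given pair degrees, by its value at
  a single corner, where \<open>Phi_coeff\<close> is nonzero; so the solution is a multiple of \<open>Phi_coeff\<close>
  (\<open>q_recurrence_imp_Phi_coeff\<close>).
\<close>

section \<open>Power series in several variables\<close>

definition monomial :: "complex ^ 'n::finite \<Rightarrow> ('n \<Rightarrow> nat) \<Rightarrow> complex" where
  "monomial z m = (\<Prod>i\<in>UNIV. z $ i ^ m i)"

definition raise :: "'n \<Rightarrow> ('n \<Rightarrow> nat) \<Rightarrow> 'n \<Rightarrow> nat" where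
  "raise i m = m(i := Suc (m i))"

text \<open>
  The domain of convergence is an open polydisc with the same radius in all variables. It is stable
  under replacing one coordinate by any number of norm below the radius, as the q-derivative and the
  q-shift do, and under scaling each coordinate by its own factor in the unit disc.
\<close>

definition power_series_on ::
    "(('n::finite \<Rightarrow> nat) \<Rightarrow> complex) \<Rightarrow> real \<Rightarrow> (complex ^ 'n \<Rightarrow> complex) \<Rightarrow> bool" where
  "power_series_on c r f \<longleftrightarrow>
     (\<forall>z. (\<forall>i. norm (z $ i) < r) \<longrightarrow> ((\<lambda>m. c m * monomial z m) has_sum f z) UNIV)"

lemma power_series_onD:
  "power_series_on c r f \<Longrightarrow> (\<And>i. norm (z $ i) < r) \<Longrightarrow>
     ((\<lambda>m. c m * monomial z m) has_sum f z) UNIV"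
  by (auto simp: power_series_on_def)

lemma power_series_on_mono:
  "power_series_on c r f \<Longrightarrow> s \<le> r \<Longrightarrow> power_series_on c s f"
  unfolding power_series_on_def by (meson less_le_trans)

lemma power_series_on_cong:
  "power_series_on c r f \<Longrightarrow> (\<And>z. (\<And>i. norm (z $ i) < r) \<Longrightarrow> f z = g z) \<Longrightarrow> power_series_on c r g"
  unfolding power_series_on_def by simp

lemma power_series_on_diff:
  fixes f g :: "complex ^ 'n::finite \<Rightarrow> complex"
  assumes "power_series_on c r f" "power_series_on d r g"
  shows "power_series_on (\<lambda>m. c m - d m) r (\<lambda>z. f z - g z)"
  unfolding power_series_on_def
proof (intro allI impI)
  fix z :: "complex ^ 'n" assume z: "\<forall>i. norm (z $ i) < r"
  have "((\<lambda>m. c m * monomial z m + - (d m * monomial z m)) has_sum (f z + - g z)) UNIV"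
    using z by (intro has_sum_add has_sum_uminusI power_series_onD[OF assms(1)]
        power_series_onD[OF assms(2)]) auto
  then show "((\<lambda>m. (c m - d m) * monomial z m) has_sum (f z - g z)) UNIV"
    by (simp add: algebra_simps)
qed

lemma power_series_on_cmult:
  assumes "power_series_on c r f"
  shows "power_series_on (\<lambda>m. s * c m) r (\<lambda>z. s * f z)"
  using assms has_sum_cmult_right[where c = s] unfolding power_series_on_def
  by (fastforce simp: mult.assoc)

lemma eventually_nhds_0_polydisc:
  fixes P :: "complex ^ 'n::finite \<Rightarrow> bool"
  shows "(\<forall>\<^sub>F z in nhds 0. P z) \<longleftrightarrow> (\<exists>r>0. \<forall>z. (\<forall>i. norm (z $ i) < r) \<longrightarrow> P z)"
proof
  assume "\<forall>\<^sub>F z in nhds 0. P z"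
  then obtain e where e: "e > 0" "\<And>z. norm z < e \<Longrightarrow> P z"
    by (auto simp: eventually_nhds_metric)
  have "P z" if "\<forall>i. norm (z $ i) < e / CARD('n)" for z :: "complex ^ 'n"
  proof -
    have "norm z \<le> (\<Sum>i\<in>UNIV. norm (z $ i))"
      unfolding norm_vec_def by (rule L2_set_le_sum) auto
    also have "\<dots> < (\<Sum>i\<in>(UNIV::'n set). e / CARD('n))"
      using that by (intro sum_strict_mono) auto
    finally show ?thesis using e by simp
  qed
  then show "\<exists>r>0. \<forall>z. (\<forall>i. norm (z $ i) < r) \<longrightarrow> P z"
    using e(1) by (intro exI[of _ "e / CARD('n)"]) auto
next
  assume "\<exists>r>0. \<forall>z. (\<forall>i. norm (z $ i) < r) \<longrightarrow> P z"
  then obtain r where r: "r > 0" "\<And>z. (\<forall>i. norm (z $ i) < r) \<Longrightarrow> P z" by blast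
  have "P z" if "norm z < r" for z :: "complex ^ 'n"
    using r(2)[of z] that Finite_Cartesian_Product.norm_nth_le[of z] by (meson le_less_trans)
  then show "\<forall>\<^sub>F z in nhds 0. P z"
    using r(1) by (auto simp: eventually_nhds_metric)
qed

lemma mv_analytic_at_0_iff:
  "mv_analytic_at f 0 \<longleftrightarrow> (\<exists>c. \<exists>r>0. power_series_on c r f)"
  unfolding mv_analytic_at_def eventually_nhds_0_polydisc power_series_on_def monomial_def
  by simp

lemma upd_nth [simp]: "upd z i t $ l = (if l = i then t else z $ l)"
  by (simp add: upd_def)

lemma upd_upd [simp]: "upd (upd z i s) i t = upd z i t"
  by (simp add: vec_eq_iff)

lemma upd_self [simp]: "upd z i (z $ i) = z"
  by (simp add: vec_eq_iff)

lemma monomial_split: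
  "monomial z m = z $ i ^ m i * (\<Prod>l\<in>UNIV - {i}. z $ l ^ m l)"
  unfolding monomial_def by (rule prod.remove) auto

lemma monomial_upd:
  "monomial (upd z i t) m = t ^ m i * (\<Prod>l\<in>UNIV - {i}. z $ l ^ m l)"
  by (subst monomial_split[of _ _ i]) auto

lemma monomial_raise: "monomial z (raise i m) = z $ i * monomial z m"
  by (subst (1 2) monomial_split[of _ _ i]) (simp add: raise_def)

section \<open>The q-derivative of a power series\<close>

lemma power_series_on_qshift:
  fixes f :: "complex ^ 'n::finite \<Rightarrow> complex"
  assumes "norm q < 1" "power_series_on c r f"
  shows "power_series_on (\<lambda>m. q ^ m i * c m) r (qshift q i f)"
  unfolding power_series_on_def
proof (intro allI impI)
  fix z :: "complex ^ 'n" assume z: "\<forall>i. norm (z $ i) < r"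
  have "norm (q * z $ i) \<le> 1 * norm (z $ i)"
    unfolding norm_mult using assms(1) by (intro mult_right_mono) auto
  then have "norm (q * z $ i) < r" using z by (metis mult_1 le_less_trans)
  then have "((\<lambda>m. c m * monomial (upd z i (q * z $ i)) m) has_sum f (upd z i (q * z $ i))) UNIV"
    using z by (intro power_series_onD[OF assms(2)]) auto
  then show "((\<lambda>m. q ^ m i * c m * monomial z m) has_sum qshift q i f z) UNIV"
    unfolding qshift_def monomial_upd monomial_split[of z _ i]
    by (simp add: power_mult_distrib mult_ac)
qed

text \<open>
  The difference \<open>f - qshift q i f\<close> has coefficients \<open>(1 - q ^ m i) * c m\<close>. They vanish where
  \<open>m i = 0\<close>, so every remaining monomial is divisible by \<open>z $ i\<close>.
\<close>

lemma has_sum_q_quotient: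
  assumes q: "norm q < 1" and f: "power_series_on c r f"
    and z: "\<And>l. norm (z $ l) < r" "z $ i \<noteq> 0"
  shows "((\<lambda>m. (1 - q ^ Suc (m i)) * c (raise i m) * monomial z m) has_sum
           (f z - qshift q i f z) / z $ i) UNIV"
proof -
  have "power_series_on (\<lambda>m. c m - q ^ m i * c m) r (\<lambda>z. f z - qshift q i f z)"
    by (intro power_series_on_diff f power_series_on_qshift q)
  then have "((\<lambda>m. (c m - q ^ m i * c m) * monomial z m) has_sum (f z - qshift q i f z)) UNIV"
    by (rule power_series_onD) (rule z)
  then have "((\<lambda>m. (c m - q ^ m i * c m) * monomial z m) has_sum (f z - qshift q i f z))
      {m. m i \<noteq> 0}"
    by (subst has_sum_cong_neutral[where T = UNIV]) auto
  moreover have "bij_betw (raise i) UNIV {m. m i \<noteq> 0}"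
    by (rule bij_betw_byWitness[where f' = "\<lambda>m. m(i := m i - 1)"])
      (auto simp: raise_def fun_eq_iff)
  ultimately have "((\<lambda>m. (c (raise i m) - q ^ raise i m i * c (raise i m)) *
      monomial z (raise i m)) has_sum (f z - qshift q i f z)) UNIV"
    by (simp only: has_sum_reindex_bij_betw
        [where f = "\<lambda>m. (c m - q ^ m i * c m) * monomial z m"])
  then have "((\<lambda>m. z $ i * ((1 - q ^ Suc (m i)) * c (raise i m) * monomial z m))
      has_sum (f z - qshift q i f z)) UNIV"
    unfolding monomial_raise by (simp add: raise_def algebra_simps)
  then show ?thesis
    using z(2) by (subst (asm) has_sum_cmult_right_iff) auto
qed

text \<open>
  Off the hyperplane \<open>z $ i = 0\<close> this is \<open>has_sum_q_quotient\<close>. On it the q-derivative is defined as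
  a limit of quotients; the quotients are sums of the differentiated series, and the limit may be taken
  termwise since its terms are dominated by those at \<open>z $ i = r / 2\<close>.
\<close>

lemma power_series_on_qpartial:
  fixes f :: "complex ^ 'n::finite \<Rightarrow> complex"
  assumes q: "norm q < 1" and f: "power_series_on c r f"
  shows "power_series_on (\<lambda>m. (1 - q ^ Suc (m i)) * c (raise i m)) r (qpartial q i f)"
  unfolding power_series_on_def
proof (intro allI impI)
  fix z :: "complex ^ 'n" assume z: "\<forall>l. norm (z $ l) < r"
  define d where "d m = (1 - q ^ Suc (m i)) * c (raise i m)" for m
  show "((\<lambda>m. d m * monomial z m) has_sum qpartial q i f z) UNIV"
  proof (cases "z $ i = 0")
    case False
    then show ?thesis
      using has_sum_q_quotient[OF q f, of z i] z
      by (simp add: d_def qpartial_def qderiv_def qshift_def)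
  next
    case True
    \<comment> \<open>Any number strictly between \<open>0\<close> and \<open>r\<close> would do.\<close>
    define \<rho> where "\<rho> = r / 2"
    have "r > 0" using z by (meson le_less_trans norm_ge_zero)
    then have \<rho>: "0 < \<rho>" "\<rho> < r" by (auto simp: \<rho>_def)
    define S where "S t = (\<Sum>\<^sub>\<infinity>m. d m * monomial (upd z i t) m)" for t
    define M where "M m = norm (d m * monomial (upd z i (of_real \<rho>)) m)" for m
    have quot: "((\<lambda>m. d m * monomial (upd z i t) m) has_sum
        (f (upd z i t) - f (upd z i (q * t))) / t) UNIV" if "t \<noteq> 0" "norm t \<le> \<rho>" for t
      using has_sum_q_quotient[OF q f, of "upd z i t" i] that z \<rho>
      by (simp add: d_def qshift_def)
    have "(\<lambda>m. d m * monomial (upd z i (of_real \<rho>)) m) summable_on UNIV"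
      using \<rho> by (intro has_sum_imp_summable[OF quot]) auto
    then have M: "M summable_on UNIV"
      unfolding M_def by (simp add: summable_on_iff_abs_summable_on_complex)
    have le_M: "norm (d m * monomial (upd z i t) m) \<le> M m" if "t \<in> cball 0 \<rho>" for m t
      unfolding M_def monomial_upd norm_mult using that \<rho>
      by (intro mult_mono) (auto simp: norm_power intro!: power_mono)
    have "uniform_limit (cball 0 \<rho>) (\<lambda>X t. \<Sum>m\<in>X. d m * monomial (upd z i t) m) S
        (finite_subsets_at_top UNIV)"
      unfolding S_def using le_M M by (intro Weierstrass_m_test_general) auto
    then have "continuous_on (cball 0 \<rho>) S"
      by (rule uniform_limit_theorem[rotated])
        (auto simp: monomial_upd intro!: always_eventually continuous_intros)
    then have "isCont S 0"
      using \<rho> continuous_on_interior[of "cball 0 \<rho>" S 0] by (auto simp: interior_cball)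
    then have lim: "S \<midarrow>0\<rightarrow> S 0" by (simp add: isCont_def)
    have ev: "\<forall>\<^sub>F t in at 0. S t = (f (upd z i t) - f (upd z i (q * t))) / t"
      unfolding eventually_at using \<rho> quot
      by (intro exI[of _ \<rho>]) (auto simp: S_def intro!: infsumI)
    have "((\<lambda>t. (f (upd z i t) - f (upd z i (q * t))) / t) \<longlongrightarrow> S 0) (at 0)"
      by (rule iffD1[OF tendsto_cong[OF ev] lim])
    then have "qpartial q i f z = S 0"
      using True by (simp add: qpartial_def qderiv_def tendsto_Lim)
    moreover have "(\<lambda>m. d m * monomial (upd z i 0) m) summable_on UNIV"
      unfolding summable_on_iff_abs_summable_on_complex
      by (rule Infinite_Sum.summable_on_comparison_test[OF M]) (use le_M \<rho> in auto)
    then have "((\<lambda>m. d m * monomial (upd z i 0) m) has_sum S 0) UNIV"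
      unfolding S_def by (rule has_sum_infsum)
    moreover have "upd z i 0 = z" using True by (simp add: vec_eq_iff)
    ultimately show ?thesis by simp
  qed
qed

text \<open>
  For \<open>q = 0\<close> the factors \<open>1 - q ^ Suc (m i)\<close> are all \<open>1\<close>, so \<open>qpartial 0 i\<close> is the backward shift of
  the coefficients in direction \<open>i\<close>. It maps the zero function to itself. Shifting repeatedly moves
  any coefficient to the constant term, which is the value at the origin.
\<close>

lemma power_series_zero_imp_coeff_zero:
  assumes "power_series_on c r (\<lambda>_. 0)" "r > 0"
  shows "c m = 0"
  using assms(1)
proof (induction "\<Sum>i\<in>UNIV. m i" arbitrary: c m)
  case 0
  then have m: "m = (\<lambda>_. 0)" by auto
  have "((\<lambda>m. c m * monomial 0 m) has_sum 0) UNIV"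
    using power_series_onD[OF 0(2), of 0] assms(2) by simp
  moreover have "((\<lambda>m. c m * monomial 0 m) has_sum c (\<lambda>_. 0)) UNIV"
  proof (rule has_sum_finite_neutralI[where B = "{\<lambda>_. 0}"])
    fix k :: "'a \<Rightarrow> nat" assume "k \<in> UNIV - {\<lambda>_. 0}"
    then obtain i where "k i \<noteq> 0" by auto
    then show "c k * monomial 0 k = 0" by (simp add: monomial_split[of _ _ i])
  qed (auto simp: monomial_def)
  ultimately show ?case using m has_sum_unique by blast
next
  case (Suc s)
  from Suc(2) obtain i where i: "m i \<noteq> 0"
    by (metis Suc_neq_Zero sum.neutral)
  have m: "m = raise i (m(i := m i - 1))"
    using i by (auto simp: raise_def)
  have "Suc s = Suc (\<Sum>l\<in>UNIV. (m(i := m i - 1)) l)"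
    using i unfolding Suc(2) by (simp add: sum.remove[of UNIV i])
  moreover have "qpartial 0 i (\<lambda>_. 0) = (\<lambda>_. 0)"
    by (auto simp: qpartial_def qderiv_def tendsto_Lim)
  then have "power_series_on (\<lambda>m. c (raise i m)) r (\<lambda>_. 0)"
    using power_series_on_qpartial[OF _ Suc(3), of 0 i] by simp
  ultimately have "c (raise i (m(i := m i - 1))) = 0"
    using Suc(1) by blast
  then show ?case using m by simp
qed

lemma power_series_on_unique:
  assumes "power_series_on c r f" "power_series_on d r f" "r > 0"
  shows "c = d"
proof
  fix m
  have "power_series_on (\<lambda>m. c m - d m) r (\<lambda>_. 0)"
    using power_series_on_diff[OF assms(1,2)] by simp
  then have "c m - d m = 0"
    using power_series_zero_imp_coeff_zero assms(3) by fast
  then show "c m = d m" by simp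
qed

section \<open>Grouping the variables in pairs\<close>

definition pair_degree :: "('k + 'k \<Rightarrow> nat) \<Rightarrow> 'k \<Rightarrow> nat" where
  "pair_degree m j = m (Inl j) + m (Inr j)"

definition Phi_coeff ::
    "complex \<Rightarrow> ('k::finite \<Rightarrow> complex) \<Rightarrow> ('k \<Rightarrow> complex) \<Rightarrow> ('k + 'k \<Rightarrow> nat) \<Rightarrow> complex" where
  "Phi_coeff q a b m =
     (\<Prod>j\<in>UNIV. qbinom q (pair_degree m j) (m (Inl j)) *
        qpoch (a j) q (m (Inl j)) * qpoch (b j) q (m (Inr j)))"

lemma pair_degree_raise [simp]:
  "pair_degree (raise (Inl j) m) = raise j (pair_degree m)"
  "pair_degree (raise (Inr j) m) = raise j (pair_degree m)"
  by (auto simp: pair_degree_def raise_def fun_eq_iff)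

lemma prod_UNIV_sum:
  fixes g :: "'k::finite + 'k \<Rightarrow> complex"
  shows "(\<Prod>i\<in>UNIV. g i) = (\<Prod>j\<in>UNIV. g (Inl j) * g (Inr j))"
  unfolding UNIV_Plus_UNIV[symmetric] by (simp add: prod.Plus prod.distrib del: UNIV_Plus_UNIV)

text \<open>
  A multi-index with given pair degrees is determined by its exponents of the \<open>x\<^sub>j\<close>. This turns a
  product of the sums defining \<open>Phi\<close> into one sum over multi-indices.
\<close>

lemma bij_betw_pair_degree:
  fixes n :: "'k::finite \<Rightarrow> nat"
  shows "bij_betw (\<lambda>k. case_sum k (\<lambda>j. n j - k j)) (PiE UNIV (\<lambda>j. {..n j}))
     {m. pair_degree m = n}"
proof (rule bij_betw_byWitness[where f' = "\<lambda>m. m \<circ> Inl"])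
  show "\<forall>m\<in>{m. pair_degree m = n}. case_sum (m \<circ> Inl) (\<lambda>j. n j - (m \<circ> Inl) j) = m"
    by (auto simp: pair_degree_def intro!: ext split: sum.splits)
next
  show "(\<lambda>m. m \<circ> Inl) ` {m. pair_degree m = n} \<subseteq> PiE UNIV (\<lambda>j. {..n j})"
    by (auto simp: pair_degree_def)
qed (auto simp: pair_degree_def fun_eq_iff PiE_iff)

lemma finite_pair_degree: "finite {m. pair_degree m = (n :: 'k::finite \<Rightarrow> nat)}"
  using bij_betw_finite[OF bij_betw_pair_degree[of n]] by (simp add: finite_PiE)

lemma sum_Phi_coeff_monomial:
  "(\<Sum>m | pair_degree m = n. Phi_coeff q a b m * monomial z m) =
     (\<Prod>j\<in>UNIV. Phi q (a j) (b j) (n j) (z $ Inl j) (z $ Inr j))"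
proof -
  let ?g = "\<lambda>j k. qbinom q (n j) k * qpoch (a j) q k * qpoch (b j) q (n j - k) *
      z $ Inl j ^ k * z $ Inr j ^ (n j - k)"
  have "(\<Prod>j\<in>UNIV. Phi q (a j) (b j) (n j) (z $ Inl j) (z $ Inr j)) =
      (\<Sum>k\<in>PiE UNIV (\<lambda>j. {..n j}). \<Prod>j\<in>UNIV. ?g j (k j))"
    unfolding Phi_def by (rule prod_sum_PiE) auto
  also have "\<dots> = (\<Sum>m | pair_degree m = n. \<Prod>j\<in>UNIV. ?g j (m (Inl j)))"
    by (subst sum.reindex_bij_betw[OF bij_betw_pair_degree, symmetric]) simp
  also have "\<dots> = (\<Sum>m | pair_degree m = n. Phi_coeff q a b m * monomial z m)"
  proof (rule sum.cong)
    fix m assume "m \<in> {m. pair_degree m = n}"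
    then have "n j - m (Inl j) = m (Inr j)" "n j = pair_degree m j" for j
      by (auto simp: pair_degree_def)
    then show "(\<Prod>j\<in>UNIV. ?g j (m (Inl j))) = Phi_coeff q a b m * monomial z m"
      unfolding Phi_coeff_def monomial_def prod_UNIV_sum prod.distrib[symmetric]
      by (simp add: mult_ac)
  qed simp
  finally show ?thesis by simp
qed

lemma has_sum_pair_degree:
  fixes h :: "('k::finite + 'k \<Rightarrow> nat) \<Rightarrow> complex"
  assumes "(h has_sum s) UNIV"
  shows "((\<lambda>n. \<Sum>m | pair_degree m = n. h m) has_sum s) UNIV"
proof (rule has_sum_SigmaD)
  have "bij_betw snd (SIGMA n:UNIV. {m. pair_degree m = n}) (UNIV :: ('k + 'k \<Rightarrow> nat) set)"
    by (rule bij_betw_byWitness[where f' = "\<lambda>m. (pair_degree m, m)"]) auto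
  from has_sum_reindex_bij_betw[OF this, of h] assms
  show "((\<lambda>p. h (snd p)) has_sum s) (SIGMA n:UNIV. {m. pair_degree m = n})" by simp
qed (auto intro!: has_sum_finiteI finite_pair_degree)

section \<open>The system as a recurrence\<close>

definition q_recurrence ::
    "complex \<Rightarrow> ('k::finite \<Rightarrow> complex) \<Rightarrow> ('k \<Rightarrow> complex) \<Rightarrow> (('k + 'k \<Rightarrow> nat) \<Rightarrow> complex) \<Rightarrow> bool"
  where
  "q_recurrence q a b c \<longleftrightarrow>
     (\<forall>j m. (1 - q ^ Suc (m (Inl j))) * (1 - b j * q ^ m (Inr j)) * c (raise (Inl j) m) =
            (1 - q ^ Suc (m (Inr j))) * (1 - a j * q ^ m (Inl j)) * c (raise (Inr j) m))"

text \<open>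
  The two sides of the \<open>j\<close>-th equation are the instances with \<open>i\<close>, \<open>l\<close> being \<open>Inl j\<close>, \<open>Inr j\<close> and
  vice versa. As \<open>i \<noteq> l\<close>, the q-derivative leaves the exponent \<open>m l\<close> in the factor
  \<open>1 - s * q ^ m l\<close> unchanged.
\<close>

lemma power_series_on_q_operator:
  assumes "norm q < 1" "power_series_on c r f" "i \<noteq> l"
  shows "power_series_on (\<lambda>m. (1 - q ^ Suc (m i)) * (1 - s * q ^ m l) * c (raise i m)) r
           (qpartial q i (\<lambda>w. f w - s * qshift q l f w))"
proof -
  have "power_series_on (\<lambda>m. c m - s * (q ^ m l * c m)) r (\<lambda>w. f w - s * qshift q l f w)"
    by (intro power_series_on_diff power_series_on_cmult power_series_on_qshift assms)
  from power_series_on_qpartial[OF assms(1) this, of i] show ?thesis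
    using assms(3) by (simp add: raise_def algebra_simps)
qed

lemma q_pde_system_iff_recurrence:
  fixes f :: "complex ^ ('k::finite + 'k) \<Rightarrow> complex"
  assumes q: "norm q < 1" and f: "power_series_on c r f" "r > 0"
  shows "q_pde_system q a b f \<longleftrightarrow> q_recurrence q a b c"
proof -
  have "(\<forall>\<^sub>F z in nhds 0.
          qpartial q (Inl j) (\<lambda>w. f w - b j * qshift q (Inr j) f w) z =
          qpartial q (Inr j) (\<lambda>w. f w - a j * qshift q (Inl j) f w) z) \<longleftrightarrow>
        (\<forall>m. (1 - q ^ Suc (m (Inl j))) * (1 - b j * q ^ m (Inr j)) * c (raise (Inl j) m) =
             (1 - q ^ Suc (m (Inr j))) * (1 - a j * q ^ m (Inl j)) * c (raise (Inr j) m))"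
    (is "(\<forall>\<^sub>F z in nhds 0. ?L z = ?R z) \<longleftrightarrow> (\<forall>m. ?cL m = ?cR m)") for j
  proof -
    have L: "power_series_on ?cL r ?L" and R: "power_series_on ?cR r ?R"
      by (rule power_series_on_q_operator[OF q f(1)], simp)+
    show ?thesis
    proof
      assume "\<forall>\<^sub>F z in nhds 0. ?L z = ?R z"
      then obtain s where s: "s > 0" "\<And>z. (\<forall>i. norm (z $ i) < s) \<Longrightarrow> ?L z = ?R z"
        unfolding eventually_nhds_0_polydisc by blast
      have "power_series_on ?cL (min r s) ?L" "power_series_on ?cR (min r s) ?R"
        by (rule power_series_on_mono[OF L] power_series_on_mono[OF R], simp)+
      moreover from this(2) have "power_series_on ?cR (min r s) ?L"
        by (rule power_series_on_cong) (use s(2) in auto)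
      ultimately have "?cL = ?cR"
        using power_series_on_unique[of ?cL "min r s" ?L ?cR] s(1) f(2) by simp
      then show "\<forall>m. ?cL m = ?cR m" by meson
    next
      assume eq: "\<forall>m. ?cL m = ?cR m"
      have "?L z = ?R z" if "\<forall>i. norm (z $ i) < r" for z
      proof (rule has_sum_unique)
        show "((\<lambda>m. ?cR m * monomial z m) has_sum ?L z) UNIV"
          using power_series_onD[OF L, of z] that eq by simp
        show "((\<lambda>m. ?cR m * monomial z m) has_sum ?R z) UNIV"
          using power_series_onD[OF R, of z] that by simp
      qed
      then show "\<forall>\<^sub>F z in nhds 0. ?L z = ?R z"
        unfolding eventually_nhds_0_polydisc using f(2) by blast
    qed
  qed
  then show ?thesis unfolding q_pde_system_def q_recurrence_def by simp
qed

lemma one_minus_q_power_nonzero: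
  fixes q :: complex
  assumes "norm q < 1"
  shows "1 - q ^ Suc n \<noteq> 0"
proof
  assume "1 - q ^ Suc n = 0"
  then have "norm q ^ Suc n = 1" by (metis eq_iff_diff_eq_0 norm_one norm_power)
  then show False using assms power_Suc_less_one[of "norm q" n] by (cases "q = 0") auto
qed

lemma qpoch_0 [simp]: "qpoch s q 0 = 1"
  by (simp add: qpoch_def)

lemma qpoch_Suc: "qpoch s q (Suc n) = qpoch s q n * (1 - s * q ^ n)"
  by (simp add: qpoch_def)

lemma qpoch_q_nonzero: "norm q < 1 \<Longrightarrow> qpoch q q n \<noteq> 0"
  using one_minus_q_power_nonzero[of q] by (induction n) (auto simp: qpoch_Suc)

text \<open>
  Only the \<open>j\<close>-th factor changes; let \<open>k\<close> and \<open>l\<close> be the exponents of \<open>x\<^sub>j\<close> and \<open>y\<^sub>j\<close>. Raising \<open>k\<close> multiplies it by \<open>(1 - a\<^sub>j q\<^sup>k) / (1 - q\<^sup>k\<^sup>+\<^sup>1)\<close>, and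
  raising \<open>l\<close> multiplies it by \<open>(1 - b\<^sub>j q\<^sup>l) / (1 - q\<^sup>l\<^sup>+\<^sup>1)\<close>, apart from the common factor
  \<open>1 - q\<^sup>k\<^sup>+\<^sup>l\<^sup>+\<^sup>1\<close>.
\<close>

lemma q_recurrence_Phi_coeff:
  assumes q: "norm q < 1"
  shows "q_recurrence q a b (Phi_coeff q a b)"
  unfolding q_recurrence_def
proof (intro allI)
  fix j m
  define rest where "rest = (\<Prod>l\<in>UNIV - {j}. qbinom q (pair_degree m l) (m (Inl l)) *
        qpoch (a l) q (m (Inl l)) * qpoch (b l) q (m (Inr l)))"
  define k l where "k = m (Inl j)" and "l = m (Inr j)"
  have L: "Phi_coeff q a b (raise (Inl j) m) =
      qbinom q (Suc (k + l)) (Suc k) * qpoch (a j) q (Suc k) * qpoch (b j) q l * rest"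
    unfolding Phi_coeff_def rest_def k_def l_def
    by (subst prod.remove[of _ j]) (auto simp: raise_def pair_degree_def)
  have R: "Phi_coeff q a b (raise (Inr j) m) =
      qbinom q (Suc (k + l)) k * qpoch (a j) q k * qpoch (b j) q (Suc l) * rest"
    unfolding Phi_coeff_def rest_def k_def l_def
    by (subst prod.remove[of _ j]) (auto simp: raise_def pair_degree_def)
  have "(1 - q ^ Suc k) * qbinom q (Suc (k + l)) (Suc k) =
        (1 - q ^ Suc l) * qbinom q (Suc (k + l)) k"
    using qpoch_q_nonzero[OF q] one_minus_q_power_nonzero[OF q]
    by (simp add: qbinom_def qpoch_Suc[of q q k] qpoch_Suc[of q q l] Suc_diff_le divide_simps)
  from arg_cong[OF this, of "\<lambda>s. s * ((1 - b j * q ^ l) * (1 - a j * q ^ k) *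
      qpoch (a j) q k * qpoch (b j) q l * rest)"]
  show "(1 - q ^ Suc (m (Inl j))) * (1 - b j * q ^ m (Inr j)) *
        Phi_coeff q a b (raise (Inl j) m) =
      (1 - q ^ Suc (m (Inr j))) * (1 - a j * q ^ m (Inl j)) *
        Phi_coeff q a b (raise (Inr j) m)"
    unfolding L R k_def[symmetric] l_def[symmetric] qpoch_Suc by (simp only: mult_ac)
qed

section \<open>Solutions of the recurrence\<close>

text \<open>
  Both indices in an equation of the recurrence have the same pair degrees.
\<close>

lemma q_recurrence_pair_degree_cmult:
  assumes "q_recurrence q a b c"
  shows "q_recurrence q a b (\<lambda>m. lam (pair_degree m) * c m)"
  using assms unfolding q_recurrence_def pair_degree_raise by (metis mult.left_commute)

text \<open>
  All degree of the \<open>j\<close>-th pair sits in \<open>x\<^sub>j\<close> if \<open>X j\<close> holds, and in \<open>y\<^sub>j\<close> otherwise.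
\<close>

definition corner :: "('k \<Rightarrow> bool) \<Rightarrow> ('k \<Rightarrow> nat) \<Rightarrow> 'k + 'k \<Rightarrow> nat" where
  "corner X n = case_sum (\<lambda>j. if X j then n j else 0) (\<lambda>j. if X j then 0 else n j)"

text \<open>
  Where \<open>1 - a j * q ^ r\<close> never vanishes, the recurrence expresses the value at a multi-index with a
  positive exponent of \<open>y\<^sub>j\<close> by the value with one unit moved from \<open>y\<^sub>j\<close> to \<open>x\<^sub>j\<close>; where
  \<open>1 - b j * q ^ r\<close> never vanishes, the roles are exchanged. Induction on the amount of degree that
  sits in the wrong variables reaches the corner.
\<close>

lemma q_recurrence_zero_from_corner:
  fixes a b :: "'k::finite \<Rightarrow> complex"
  assumes q: "norm q < 1" and rec: "q_recurrence q a b d"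
    and a: "\<And>j r. X j \<Longrightarrow> a j * q ^ r \<noteq> 1" and b: "\<And>j r. \<not> X j \<Longrightarrow> b j * q ^ r \<noteq> 1"
    and zero: "d (corner X (pair_degree m)) = 0"
  shows "d m = 0"
  using zero
proof (induction "\<Sum>j\<in>UNIV. if X j then m (Inr j) else m (Inl j)" arbitrary: m)
  case 0
  then have z: "(if X j then m (Inr j) else m (Inl j)) = 0" for j by simp
  have "corner X (pair_degree m) i = m i" for i
    using z[of "case_sum id id i"] by (cases i) (auto simp: corner_def pair_degree_def split: if_splits)
  then have "corner X (pair_degree m) = m" by blast
  then show ?case using 0 by simp
next
  case (Suc s)
  have "(\<Sum>j\<in>UNIV. if X j then m (Inr j) else m (Inl j)) \<noteq> 0"
    using Suc(2) by linarith
  then obtain j where j: "(if X j then m (Inr j) else m (Inl j)) \<noteq> 0"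
    by (rule sum.not_neutral_contains_not_neutral)
  \<comment> \<open>One unit is moved from the wrong variable \<open>u\<close> to the right one \<open>v\<close>.\<close>
  define u v :: "'k + 'k" where "u = (if X j then Inr j else Inl j)" and "v = (if X j then Inl j else Inr j)"
  define p where "p = m(u := m u - 1)"
  have m: "m = raise u p"
    using j by (auto simp: p_def u_def raise_def fun_eq_iff split: if_splits)
  have deg: "pair_degree (raise v p) = pair_degree m"
    unfolding m by (simp add: u_def v_def)
  define w where "w k l = (if X l then k (Inr l) else k (Inl l))" for k :: "'k + 'k \<Rightarrow> nat" and l
  have "w m j = Suc (w (raise v p) j)"
    unfolding m by (auto simp: w_def u_def v_def raise_def)
  moreover have "w m l = w (raise v p) l" if "l \<noteq> j" for l
    unfolding m using that by (auto simp: w_def u_def v_def raise_def)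
  then have "sum (w m) (UNIV - {j}) = sum (w (raise v p)) (UNIV - {j})"
    by (intro sum.cong) auto
  ultimately have "sum (w m) UNIV = Suc (sum (w (raise v p)) UNIV)"
    by (simp add: sum.remove[of UNIV j])
  then have "(\<Sum>l\<in>UNIV. if X l then m (Inr l) else m (Inl l)) =
      Suc (\<Sum>l\<in>UNIV. if X l then raise v p (Inr l) else raise v p (Inl l))"
    unfolding w_def .
  then have "d (raise v p) = 0"
    using Suc(1)[of "raise v p"] Suc(2,3) deg by simp
  moreover have "(1 - q ^ Suc (p (Inl j))) * (1 - b j * q ^ p (Inr j)) * d (raise (Inl j) p) =
      (1 - q ^ Suc (p (Inr j))) * (1 - a j * q ^ p (Inl j)) * d (raise (Inr j) p)"
    using rec unfolding q_recurrence_def by blast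
  ultimately have "d (raise u p) = 0"
    using one_minus_q_power_nonzero[OF q] a[of j] b[of j]
    by (auto simp: u_def v_def split: if_splits)
  then show ?case using m by simp
qed

lemma qpoch_nonzero:
  assumes "\<And>r. s * q ^ r \<noteq> 1"
  shows "qpoch s q n \<noteq> 0"
  using assms by (auto simp: qpoch_def)

lemma Phi_coeff_corner_nonzero:
  assumes q: "norm q < 1"
    and a: "\<And>j r. X j \<Longrightarrow> a j * q ^ r \<noteq> 1" and b: "\<And>j r. \<not> X j \<Longrightarrow> b j * q ^ r \<noteq> 1"
  shows "Phi_coeff q a b (corner X n) \<noteq> 0"
  using qpoch_q_nonzero[OF q] qpoch_nonzero[OF a] qpoch_nonzero[OF b]
  by (auto simp: Phi_coeff_def corner_def pair_degree_def qbinom_def)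

text \<open>
  With \<open>lam\<close> chosen to match \<open>c\<close> at the corners, the difference of both sides solves the recurrence and
  vanishes at the corners.
\<close>

lemma q_recurrence_imp_Phi_coeff:
  assumes q: "norm q < 1" and nd: "nondegenerate q a b" and rec: "q_recurrence q a b c"
  shows "\<exists>lam. \<forall>m. c m = lam (pair_degree m) * Phi_coeff q a b m"
proof -
  define X where "X j \<longleftrightarrow> (\<forall>r. a j * q ^ r \<noteq> 1)" for j
  have a: "a j * q ^ r \<noteq> 1" if "X j" for j r using that by (simp add: X_def)
  have b: "b j * q ^ r \<noteq> 1" if "\<not> X j" for j r
    using that nd unfolding X_def nondegenerate_def by blast
  define lam where "lam n = c (corner X n) / Phi_coeff q a b (corner X n)" for n
  define d where "d m = c m - lam (pair_degree m) * Phi_coeff q a b m" for m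
  have "q_recurrence q a b (\<lambda>m. lam (pair_degree m) * Phi_coeff q a b m)"
    by (intro q_recurrence_pair_degree_cmult q_recurrence_Phi_coeff q)
  then have "q_recurrence q a b d"
    using rec unfolding q_recurrence_def d_def right_diff_distrib by metis
  moreover have "d (corner X (pair_degree m)) = 0" for m
  proof -
    have "pair_degree (corner X (pair_degree m)) = pair_degree m"
      by (auto simp: corner_def pair_degree_def fun_eq_iff)
    then show ?thesis
      using Phi_coeff_corner_nonzero[of q X a b "pair_degree m", OF q a b]
      by (simp add: d_def lam_def)
  qed
  ultimately have "d m = 0" for m
    using q_recurrence_zero_from_corner[of q a b d X, OF q _ a b] by blast
  then show ?thesis by (auto simp: d_def)
qed

section \<open>Expandability in terms of coefficients\<close>

text \<open>
  Both variables of the \<open>j\<close>-th pair are scaled by \<open>t\<^sub>j\<close>. As a function of \<open>t\<close>, the value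
  \<open>f (scale_pairs t z)\<close> is a power series whose coefficients are the components of \<open>f\<close> at \<open>z\<close> that are
  homogeneous in each pair.
\<close>

definition scale_pairs :: "complex ^ 'k \<Rightarrow> complex ^ ('k + 'k) \<Rightarrow> complex ^ ('k::finite + 'k)" where
  "scale_pairs t z = (\<chi> i. t $ (case_sum id id i) * z $ i)"

lemma scale_pairs_nth [simp]:
  "scale_pairs t z $ Inl j = t $ j * z $ Inl j" "scale_pairs t z $ Inr j = t $ j * z $ Inr j"
  by (simp_all add: scale_pairs_def)

lemma monomial_scale_pairs:
  "monomial (scale_pairs t z) m = monomial t (pair_degree m) * monomial z m"
  unfolding monomial_def prod_UNIV_sum prod.distrib[symmetric]
  by (simp add: pair_degree_def power_mult_distrib power_add mult_ac)

text \<open>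
  If the coefficients have this form, grouping the Taylor series by pair degrees gives the expansion.
  Conversely, an expansion is only known to converge pointwise, as a sum of polynomials that cannot be
  split into monomials beforehand. Uniqueness is therefore applied twice: in the scaling parameters
  \<open>t\<close> at a fixed \<open>z\<close>, which identifies the homogeneous components as polynomial functions, and then in
  \<open>z\<close> for each component, which is a finite sum.
\<close>

lemma Phi_expandable_iff_coeff:
  fixes f :: "complex ^ ('k::finite + 'k) \<Rightarrow> complex"
  assumes f: "power_series_on c r f" "r > 0"
  shows "Phi_expandable q a b f \<longleftrightarrow> (\<exists>lam. \<forall>m. c m = lam (pair_degree m) * Phi_coeff q a b m)"
proof
  assume "\<exists>lam. \<forall>m. c m = lam (pair_degree m) * Phi_coeff q a b m"
  then obtain lam where c: "\<forall>m. c m = lam (pair_degree m) * Phi_coeff q a b m" ..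
  have "((\<lambda>n. lam n * (\<Prod>j\<in>UNIV. Phi q (a j) (b j) (n j) (z $ Inl j) (z $ Inr j)))
      has_sum f z) UNIV" if "\<forall>i. norm (z $ i) < r" for z
  proof -
    have "((\<lambda>n. \<Sum>m | pair_degree m = n. c m * monomial z m) has_sum f z) UNIV"
      using that by (intro has_sum_pair_degree power_series_onD[OF f(1)]) auto
    moreover have "(\<Sum>m | pair_degree m = n. c m * monomial z m) =
        lam n * (\<Prod>j\<in>UNIV. Phi q (a j) (b j) (n j) (z $ Inl j) (z $ Inr j))" for n
      unfolding sum_Phi_coeff_monomial[symmetric] sum_distrib_left
      by (intro sum.cong) (auto simp: c)
    ultimately show ?thesis by simp
  qed
  then show "Phi_expandable q a b f"
    unfolding Phi_expandable_def eventually_nhds_0_polydisc using f(2) by blast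
next
  assume "Phi_expandable q a b f"
  then obtain lam s where s: "s > 0" and
    Phi: "\<And>z. (\<forall>i. norm (z $ i) < s) \<Longrightarrow>
      ((\<lambda>n. lam n * (\<Prod>j\<in>UNIV. Phi q (a j) (b j) (n j) (z $ Inl j) (z $ Inr j)))
        has_sum f z) UNIV"
    unfolding Phi_expandable_def eventually_nhds_0_polydisc by blast
  define \<rho> where "\<rho> = min r s"
  \<comment> \<open>The homogeneous components at \<open>z\<close>, computed from the Taylor series and from the expansion.\<close>
  define P where "P z n = (\<Sum>m | pair_degree m = n. c m * monomial z m)" for z n
  define Q where "Q z n = lam n * (\<Sum>m | pair_degree m = n. Phi_coeff q a b m * monomial z m)"
    for z n
  have P: "(P z has_sum f z) UNIV" and Q: "(Q z has_sum f z) UNIV"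
    if "\<forall>i. norm (z $ i) < \<rho>" for z
  proof -
    show "(P z has_sum f z) UNIV"
      unfolding P_def using that
      by (intro has_sum_pair_degree power_series_onD[OF f(1)]) (auto simp: \<rho>_def)
    show "(Q z has_sum f z) UNIV"
      unfolding Q_def sum_Phi_coeff_monomial using that by (intro Phi) (auto simp: \<rho>_def)
  qed
  have PQ: "P z = Q z" if z: "\<forall>i. norm (z $ i) < \<rho>" for z
  proof -
    have "norm (scale_pairs t z $ i) < \<rho>" if "\<forall>j. norm (t $ j) < 1" for t i
    proof -
      have "norm (scale_pairs t z $ i) \<le> 1 * norm (z $ i)"
        unfolding scale_pairs_def vec_lambda_beta norm_mult using that
        by (intro mult_right_mono) (auto simp: less_imp_le)
      then show ?thesis using z by (metis mult_1 le_less_trans)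
    qed
    moreover have "P (scale_pairs t z) = (\<lambda>n. P z n * monomial t n)"
      "Q (scale_pairs t z) = (\<lambda>n. Q z n * monomial t n)" for t
      by (auto simp: P_def Q_def monomial_scale_pairs sum_distrib_left
          sum_distrib_right mult_ac intro!: ext sum.cong)
    ultimately have "power_series_on (P z) 1 (\<lambda>t. f (scale_pairs t z))"
      and "power_series_on (Q z) 1 (\<lambda>t. f (scale_pairs t z))"
      using P[of "scale_pairs t z" for t] Q[of "scale_pairs t z" for t]
      by (simp_all add: power_series_on_def)
    then show ?thesis by (rule power_series_on_unique) simp
  qed
  have "c m = lam (pair_degree m) * Phi_coeff q a b m" for m
  proof -
    define d where "d k = (if pair_degree k = pair_degree m
        then c k - lam (pair_degree k) * Phi_coeff q a b k else 0)" for k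
    have "power_series_on d \<rho> (\<lambda>_. 0)"
      unfolding power_series_on_def
    proof (intro allI impI)
      fix z :: "complex ^ ('k + 'k)" assume z: "\<forall>i. norm (z $ i) < \<rho>"
      show "((\<lambda>k. d k * monomial z k) has_sum 0) UNIV"
      proof (rule has_sum_finite_neutralI[OF finite_pair_degree[of "pair_degree m"]])
        have "(\<Sum>k | pair_degree k = pair_degree m. d k * monomial z k) =
            P z (pair_degree m) - Q z (pair_degree m)"
          unfolding P_def Q_def sum_distrib_left sum_subtractf[symmetric]
          by (intro sum.cong) (auto simp: d_def algebra_simps)
        then show "0 = (\<Sum>k | pair_degree k = pair_degree m. d k * monomial z k)"
          using PQ[OF z] by simp
      qed (auto simp: d_def)
    qed
    then have "d m = 0"
      by (rule power_series_zero_imp_coeff_zero) (use f s in \<open>auto simp: \<rho>_def\<close>)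
    then show ?thesis by (simp add: d_def)
  qed
  then show "\<exists>lam. \<forall>m. c m = lam (pair_degree m) * Phi_coeff q a b m" by blast
qed

theorem theorem1p7:
  fixes q :: complex
    and a b :: "'k::finite \<Rightarrow> complex"
    and f :: "complex ^ ('k + 'k) \<Rightarrow> complex"
  assumes "norm q < 1"
    and "mv_analytic_at f 0"
  shows "(nondegenerate q a b \<longrightarrow> (Phi_expandable q a b f \<longleftrightarrow> q_pde_system q a b f)) \<and>
         (Phi_expandable q a b f \<longrightarrow> q_pde_system q a b f)"
proof -
  obtain c r where f: "power_series_on c r f" "r > 0"
    using assms(2) unfolding mv_analytic_at_0_iff by blast
  have expand: "Phi_expandable q a b f \<longleftrightarrow>
      (\<exists>lam. \<forall>m. c m = lam (pair_degree m) * Phi_coeff q a b m)"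
    by (rule Phi_expandable_iff_coeff[OF f])
  have pde: "q_pde_system q a b f \<longleftrightarrow> q_recurrence q a b c"
    by (rule q_pde_system_iff_recurrence[OF assms(1) f])
  have sufficient: "q_pde_system q a b f" if "Phi_expandable q a b f"
  proof -
    from that obtain lam where "c = (\<lambda>m. lam (pair_degree m) * Phi_coeff q a b m)"
      unfolding expand by auto
    then show ?thesis
      unfolding pde using q_recurrence_pair_degree_cmult[OF q_recurrence_Phi_coeff[OF assms(1)]]
      by simp
  qed
  have "Phi_expandable q a b f" if "nondegenerate q a b" "q_pde_system q a b f"
    using q_recurrence_imp_Phi_coeff[OF assms(1) that(1)] that(2) unfolding expand pde by blast
  with sufficient show ?thesis by blast
qed

end
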